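(* Let $X$ be a set, $X^{-1}=\{x^{-1}\mid x\in X\}$ with $X\cap X^{-1}=\varnothing$, let $<$ be a well ordering on $Y=X\cup X^{-1}$, and denote also by $<$ the corresponding deg-lex ordering of $Y^*$. Let $S\subset Y^*\times Y^*$ be the set of the following relations: (a) $(ef,fe)$, where both $e$ and $f$ are ordered prime canonical idempotents, $ef$ is a canonical idempotent and $fe<ef$; (b) $(x^{-1}e'xf'x^{-1},\ f'x^{-1}e')$, where $x\in Y$ and both $x^{-1}e'x$ and $xf'x^{-1}$ are ordered prime canonical idempotents. Let $\mathrm{Irr}(S)$ be the set of words in $Y^*$ that do not contain as a subword the first component $u$ of any pair $(u,v)\in S$. Then: (1) $\mathrm{Irr}(S)$ consists exactly of the words $u_0e_1u_1\cdots e_mu_m\in Y^*$, where $m\ge 0$, $u_0,\dots,u_m\in Y^*$, $u_1,\dots,u_{m-1}\neq 1$, the word $u_0u_1\cdots u_m$ has no subword of the form $yy^{-1}$ with $y\in Y$, $e_1,\dots,e_m$ are ordered canonical idempotents, and for each $1\le i\le m$ the first letters of the factors of $e_i$ are not equal to the first letter of $u_i$ (if $u_i\ne 1$), and the last letters of the factors of $e_i$ are not equal to the last letter of $u_{i-1}$ (if $u_{i-1}\neq 1$). (2) $\mathrm{Irr}(S)$ is a set of (unique and shortest) normal forms for the free inverse semigroup (with identity) $\mathcal{FI}(X)$: every element of $\mathcal{FI}(X)$ is represented by a word in $\mathrm{Irr}(S)$, different words in $\mathrm{Irr}(S)$ represent different elements of $\mathcal{FI}(X)$, and the word of $\mathrm{Irr}(S)$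 representing a given element has minimal length among all words in $Y^*$ representing that element.
   Context: $Y^*$ is the free monoid on $Y$, with empty word $1$; subwords are contiguous. Put $1^{-1}=1$, $(x^{-1})^{-1}=x$ for $x\in X$, and $(y_1\cdots y_n)^{-1}=y_n^{-1}\cdots y_1^{-1}$ for $y_i\in Y$. The deg-lex ordering compares two words first by length and then lexicographically. The free inverse semigroup (with identity) on $X$ is $\mathcal{FI}(X)=\mathrm{sgp}\langle Y\mid aa^{-1}a=a,\ aa^{-1}bb^{-1}=bb^{-1}aa^{-1},\ a,b\in Y^*\rangle$, i.e. the quotient of $Y^*$ by the congruence generated by these relations. Formal idempotents (words in $Y^*$) are defined inductively: (i) The empty word $1$ is an idempotent, a canonical idempotent and an ordered canonical idempotent; it has no factors. (ii) If $h$ is an idempotent and $x\in Y$, then $x^{-1}hx$ is an idempotent and a prime idempotent. If $h$ is a canonical idempotent, $x\in Y$, and the first letters of the factors of $h$ are all different from $x$, then $x^{-1}hx$ is a canonical idempotent and a prime canonical idempotent; it is its own (only) factor. If moreover $h$ is an ordered canonical idempotent, then $x^{-1}hx$ is an ordered canonical idempotent and an ordered prime canonical idempotent. (iii) If $e_1,\dots,e_m$ ($m>1$) are prime idempotents, then $e=e_1\cdots e_m$ is an idempotent. If moreover $e_1,\dots,e_m$ are prime canonical idempotents whose first letters are pairwise distinct, then $e$ is a canonical idempotent and $e_1,\dots,e_m$ are its factors. If in addition $e_1,\dots,e_m$ are ordered canonical idempotents and $e\le e_{i_1}\cdots e_{i_m}$ for every permutation $(i_1,\dots,i_m)$ of $(1,\dots,m)$,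 then $e$ is an ordered canonical idempotent. *)

theory Defs
  imports "HOL-Library.Multiset" "HOL-Library.Sublist" "HOL-Algebra.Group"
begin

text \<open>
  The generators of \<open>X\<close> and their formal inverses; the two constructors make \<open>X\<close> and
  \<open>X\<^sup>-\<^sup>1\<close> disjoint. Words over \<open>Y = letters X\<close> are the elements of
  \<open>lists (letters X)\<close>, with \<open>1 = []\<close>.
\<close>

datatype 'a letter = Pos 'a | Neg 'a

definition letters :: "'a set \<Rightarrow> 'a letter set" where
  "letters X = Pos ` X \<union> Neg ` X"

fun inv_letter :: "'a letter \<Rightarrow> 'a letter" where
  "inv_letter (Pos x) = Neg x"
| "inv_letter (Neg x) = Pos x"

definition inv_word :: "'a letter list \<Rightarrow> 'a letter list" where
  "inv_word w = rev (map inv_letter w)"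

text \<open>
  Here \<open>r\<close> is the reflexive order relation on letters, as in \<^const>\<open>well_order_on\<close>,
  whereas \<^const>\<open>lenlex\<close> expects a strict one.
\<close>

definition deglex_less :: "'a letter rel \<Rightarrow> 'a letter list \<Rightarrow> 'a letter list \<Rightarrow> bool" where
  "deglex_less r u v \<longleftrightarrow> (u, v) \<in> lenlex (r - Id)"

definition deglex_le :: "'a letter rel \<Rightarrow> 'a letter list \<Rightarrow> 'a letter list \<Rightarrow> bool" where
  "deglex_le r u v \<longleftrightarrow> deglex_less r u v \<or> u = v"


inductive_set fi_cong :: "'a set \<Rightarrow> 'a letter list rel" for X :: "'a set" where
  fi_inverse: "a \<in> lists (letters X) \<Longrightarrow> (a @ inv_word a @ a, a) \<in> fi_cong X"
| fi_commute: "\<lbrakk>a \<in> lists (letters X); b \<in> lists (letters X)\<rbrakk> \<Longrightarrow>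
    (a @ inv_word a @ b @ inv_word b, b @ inv_word b @ a @ inv_word a) \<in> fi_cong X"
| fi_refl: "a \<in> lists (letters X) \<Longrightarrow> (a, a) \<in> fi_cong X"
| fi_sym: "(a, b) \<in> fi_cong X \<Longrightarrow> (b, a) \<in> fi_cong X"
| fi_trans: "\<lbrakk>(a, b) \<in> fi_cong X; (b, c) \<in> fi_cong X\<rbrakk> \<Longrightarrow> (a, c) \<in> fi_cong X"
| fi_mult: "\<lbrakk>(a, b) \<in> fi_cong X; (c, d) \<in> fi_cong X\<rbrakk> \<Longrightarrow> (a @ c, b @ d) \<in> fi_cong X"

definition fi_class :: "'a set \<Rightarrow> 'a letter list \<Rightarrow> 'a letter list set" where
  "fi_class X w = fi_cong X `` {w}"

definition FI :: "'a set \<Rightarrow> 'a letter list set monoid" where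
  "FI X = \<lparr>carrier = lists (letters X) // fi_cong X,
           mult = (\<lambda>A B. \<Union>a\<in>A. \<Union>b\<in>B. fi_class X (a @ b)),
           one = fi_class X []\<rparr>"

lemma inv_letter_in [simp]: "inv_letter y \<in> letters X \<longleftrightarrow> y \<in> letters X"
  by (cases y) (auto simp: letters_def)

lemma inv_word_in [simp]: "inv_word w \<in> lists (letters X) \<longleftrightarrow> w \<in> lists (letters X)"
  by (auto simp: inv_word_def in_lists_conv_set)

lemma fi_cong_words:
  assumes "(a, b) \<in> fi_cong X"
  shows "a \<in> lists (letters X) \<and> b \<in> lists (letters X)"
  using assms by induction auto

lemma equiv_fi_cong: "equiv (lists (letters X)) (fi_cong X)"
proof (rule equivI)
  show "fi_cong X \<subseteq> lists (letters X) \<times> lists (letters X)"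
    using fi_cong_words by fast
  show "refl_on (lists (letters X)) (fi_cong X)"
    by (simp add: refl_on_def fi_cong.fi_refl)
  show "sym (fi_cong X)"
    by (blast intro: symI fi_cong.fi_sym)
  show "trans (fi_cong X)"
    by (blast intro: transI fi_cong.fi_trans)
qed

lemma carrier_FI: "carrier (FI X) = fi_class X ` lists (letters X)"
  by (auto simp: FI_def fi_class_def quotient_def)

lemma one_FI: "\<one>\<^bsub>FI X\<^esub> = fi_class X []"
  by (simp add: FI_def)

lemma fi_class_eq_iff:
  "a \<in> lists (letters X) \<Longrightarrow> b \<in> lists (letters X) \<Longrightarrow>
   fi_class X a = fi_class X b \<longleftrightarrow> (a, b) \<in> fi_cong X"
  unfolding fi_class_def by (rule eq_equiv_class_iff[OF equiv_fi_cong])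

lemma mult_FI:
  assumes a: "a \<in> lists (letters X)" and b: "b \<in> lists (letters X)"
  shows "fi_class X a \<otimes>\<^bsub>FI X\<^esub> fi_class X b = fi_class X (a @ b)"
proof -
  have eq: "fi_class X (a' @ b') = fi_class X (a @ b)"
    if "a' \<in> fi_class X a" "b' \<in> fi_class X b" for a' b'
  proof -
    have "(a, a') \<in> fi_cong X" "(b, b') \<in> fi_cong X"
      using that by (simp_all add: fi_class_def)
    then have "(a @ b, a' @ b') \<in> fi_cong X"
      by (rule fi_cong.fi_mult)
    then show ?thesis
      unfolding fi_class_def by (rule equiv_class_eq[OF equiv_fi_cong, symmetric])
  qed
  have "a \<in> fi_class X a" "b \<in> fi_class X b"
    using a b by (simp_all add: fi_class_def fi_cong.fi_refl)
  then have "(\<Union>a'\<in>fi_class X a. \<Union>b'\<in>fi_class X b. fi_class X (a' @ b')) = fi_class X (a @ b)"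
    using eq by blast
  then show ?thesis
    by (simp add: FI_def)
qed

lemma monoid_FI: "monoid (FI X)"
proof (rule monoidI)
  show "\<one>\<^bsub>FI X\<^esub> \<in> carrier (FI X)"
    unfolding carrier_FI one_FI by (rule imageI) simp
next
  fix A B assume "A \<in> carrier (FI X)" "B \<in> carrier (FI X)"
  then obtain a b where "a \<in> lists (letters X)" "A = fi_class X a"
      "b \<in> lists (letters X)" "B = fi_class X b"
    unfolding carrier_FI by blast
  then show "A \<otimes>\<^bsub>FI X\<^esub> B \<in> carrier (FI X)"
    unfolding carrier_FI by (simp only: mult_FI append_in_lists_conv imageI)
next
  fix A B C assume "A \<in> carrier (FI X)" "B \<in> carrier (FI X)" "C \<in> carrier (FI X)"
  then obtain a b c where "a \<in> lists (letters X)" "A = fi_class X a"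
      "b \<in> lists (letters X)" "B = fi_class X b" "c \<in> lists (letters X)" "C = fi_class X c"
    unfolding carrier_FI by blast
  then show "A \<otimes>\<^bsub>FI X\<^esub> B \<otimes>\<^bsub>FI X\<^esub> C = A \<otimes>\<^bsub>FI X\<^esub> (B \<otimes>\<^bsub>FI X\<^esub> C)"
    by (simp only: mult_FI append_in_lists_conv append_assoc simp_thms)
next
  fix A assume "A \<in> carrier (FI X)"
  then obtain a where "a \<in> lists (letters X)" "A = fi_class X a"
    unfolding carrier_FI by blast
  then show "\<one>\<^bsub>FI X\<^esub> \<otimes>\<^bsub>FI X\<^esub> A = A" "A \<otimes>\<^bsub>FI X\<^esub> \<one>\<^bsub>FI X\<^esub> = A"
    by (simp_all only: one_FI mult_FI lists.Nil append_Nil append_Nil2)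
qed


text \<open>
  \<open>canonical_idem X e es\<close> says that \<open>e\<close> is a canonical idempotent whose list of factors is
  \<open>es\<close>. General (not necessarily canonical) idempotents are not needed: the arguments of the
  rules are canonical and hence idempotents anyway.
\<close>

inductive canonical_idem :: "'a set \<Rightarrow> 'a letter list \<Rightarrow> 'a letter list list \<Rightarrow> bool"
  and prime_canonical_idem :: "'a set \<Rightarrow> 'a letter list \<Rightarrow> bool"
  for X :: "'a set"
where
  canonical_empty: "canonical_idem X [] []"
| prime_canonical: "\<lbrakk>canonical_idem X h hs; x \<in> letters X; \<forall>f\<in>set hs. hd f \<noteq> x\<rbrakk> \<Longrightarrow>
    prime_canonical_idem X ([inv_letter x] @ h @ [x])"
| canonical_prime: "prime_canonical_idem X e \<Longrightarrow> canonical_idem X e [e]"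
| canonical_prod: "\<lbrakk>length es > 1; \<forall>e\<in>set es. prime_canonical_idem X e; distinct (map hd es)\<rbrakk> \<Longrightarrow>
    canonical_idem X (concat es) es"

definition idem_factors :: "'a set \<Rightarrow> 'a letter list \<Rightarrow> 'a letter list set" where
  "idem_factors X e = {f. \<exists>es. canonical_idem X e es \<and> f \<in> set es}"

inductive ordered_idem :: "'a set \<Rightarrow> 'a letter rel \<Rightarrow> 'a letter list \<Rightarrow> bool"
  and ordered_prime_idem :: "'a set \<Rightarrow> 'a letter rel \<Rightarrow> 'a letter list \<Rightarrow> bool"
  for X :: "'a set" and r :: "'a letter rel"
where
  ordered_empty: "ordered_idem X r []"
| ordered_prime_canonical:
    "\<lbrakk>canonical_idem X h hs; x \<in> letters X; \<forall>f\<in>set hs. hd f \<noteq> x; ordered_idem X r h\<rbrakk> \<Longrightarrow>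
    ordered_prime_idem X r ([inv_letter x] @ h @ [x])"
| ordered_prime: "ordered_prime_idem X r e \<Longrightarrow> ordered_idem X r e"
| ordered_prod:
    "\<lbrakk>length es > 1; \<forall>e\<in>set es. prime_canonical_idem X e; distinct (map hd es);
      \<forall>e\<in>set es. ordered_idem X r e;
      \<forall>es'. mset es' = mset es \<longrightarrow> deglex_le r (concat es) (concat es')\<rbrakk> \<Longrightarrow>
    ordered_idem X r (concat es)"


inductive_set fi_rels :: "'a set \<Rightarrow> 'a letter rel \<Rightarrow> ('a letter list \<times> 'a letter list) set"
  for X :: "'a set" and r :: "'a letter rel"
where
  rel_a: "\<lbrakk>ordered_prime_idem X r e; ordered_prime_idem X r f; canonical_idem X (e @ f) fs;
      deglex_less r (f @ e) (e @ f)\<rbrakk> \<Longrightarrow>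
    (e @ f, f @ e) \<in> fi_rels X r"
| rel_b: "\<lbrakk>x \<in> letters X; ordered_prime_idem X r ([inv_letter x] @ e @ [x]);
      ordered_prime_idem X r ([x] @ f @ [inv_letter x])\<rbrakk> \<Longrightarrow>
    ([inv_letter x] @ e @ [x] @ f @ [inv_letter x], f @ [inv_letter x] @ e) \<in> fi_rels X r"

definition Irr :: "'a set \<Rightarrow> ('a letter list \<times> 'a letter list) set \<Rightarrow> 'a letter list set" where
  "Irr X S = {w \<in> lists (letters X). \<forall>(u, v)\<in>S. \<not> sublist u w}"

end

theory Submission
  imports Defs
begin

text \<open>
  A word over \<open>Y = letters X\<close> is read as a walk in the Cayley tree of the free group on \<open>X\<close>,
  starting at the root. The finite set of visited vertices (the Munn tree) and the endpoint are
  invariants of \<^const>\<open>fi_cong\<close>, because both generating relations preserve them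
  (\<open>fi_cong_munn\<close>).

  In this picture a canonical idempotent is a closed depth-first traversal of a subtree, its
  factors are the branches at the root, and it is ordered if siblings are always visited in
  increasing order of the edge leading to them (\<open>ordered_idem_imp_traversal\<close>,
  \<open>traversal_imp_ordered_idem\<close>). The words described in part (1) are the economical walks: they
  follow the geodesic from the root to the endpoint, and at each of its vertices make an ordered
  traversal of everything that hangs off the geodesic there (predicate \<open>walk\<close>). The tree and the
  endpoint dictate every step of such a walk, so two of them that are congruent coincide
  (\<open>walk_unique\<close>).

  Two further facts suffice. A word containing neither left-hand side is an economical walk
  (\<open>Irr_imp_walk\<close>): if a step were put in front that broke the shape, the walk would either
  re-enter a branch it has already left, which is an instance of (b), or close a branch that
  precedes a smaller sibling, an instance of (a). And both relations hold in the free inverse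
  monoid and decrease the deg-lex order (\<open>fi_rels_decrease\<close>), so the deg-lex least word of any
  class is irreducible (\<open>minimal_imp_Irr\<close>). As the least word of a class is therefore an economical
  walk, and a class contains only one of those, the economical walks, the irreducible words and the
  deg-lex least words are the same, and the four claims follow.
\<close>

lemma inv_letter_inv_letter [simp]: "inv_letter (inv_letter y) = y"
  by (cases y) auto

section \<open>The Munn tree of a word\<close>

text \<open>
  Left multiplication by a letter on the free group, whose elements are represented by reduced
  words. Words act from the left, so that their Munn data can be computed by recursion from the
  first letter.
\<close>

definition push :: "'a letter \<Rightarrow> 'a letter list \<Rightarrow> 'a letter list" where
  "push y t = (case t of [] \<Rightarrow> [y] | z # s \<Rightarrow> if z = inv_letter y then s else y # t)"

fun reduced :: "'a letter list \<Rightarrow> bool" where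
  "reduced [] \<longleftrightarrow> True"
| "reduced [y] \<longleftrightarrow> True"
| "reduced (y # z # t) \<longleftrightarrow> z \<noteq> inv_letter y \<and> reduced (z # t)"

text \<open>
  Putting \<open>y\<close> in front of a walk translates the walk by \<open>y\<close> and adds the root to the visited
  vertices. Letting a word act on an arbitrary pair of vertex set and endpoint, rather than only
  on the data of the empty word, turns congruence into equality of transformations, which is
  preserved by concatenation for free.
\<close>

definition endpoint :: "'a letter list \<Rightarrow> 'a letter list \<Rightarrow> 'a letter list" where
  "endpoint w g = foldr push w g"

definition visit :: "'a letter list \<Rightarrow> 'a letter list set \<Rightarrow> 'a letter list set" where
  "visit w T = foldr (\<lambda>y T. insert [] (push y ` T)) w T"

definition tree :: "'a letter list \<Rightarrow> 'a letter list set" where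
  "tree w = visit w {[]}"

definition pointed :: "'a letter list set \<Rightarrow> bool" where
  "pointed T \<longleftrightarrow> [] \<in> T \<and> (\<forall>t\<in>T. reduced t)"

lemma reduced_Cons: "reduced (y # t) \<longleftrightarrow> reduced t \<and> (\<forall>s. t \<noteq> inv_letter y # s)"
  by (cases t) auto

lemma reduced_push [simp]: "reduced t \<Longrightarrow> reduced (push y t)"
  by (auto simp: push_def reduced_Cons split: list.split)

lemma push_cancel: "reduced t \<Longrightarrow> push y (push (inv_letter y) t) = t"
  by (auto simp: push_def reduced_Cons split: list.split)

lemma push_eq_Cons: "(\<And>s. t \<noteq> inv_letter y # s) \<Longrightarrow> push y t = y # t"
  by (auto simp: push_def split: list.split)

lemma endpoint_simps [simp]:
  "endpoint [] g = g"
  "endpoint (y # w) g = push y (endpoint w g)"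
  "endpoint (v @ w) g = endpoint v (endpoint w g)"
  by (simp_all add: endpoint_def)

lemma visit_simps [simp]:
  "visit [] T = T"
  "visit (y # w) T = insert [] (push y ` visit w T)"
  "visit (v @ w) T = visit v (visit w T)"
  by (simp_all add: visit_def)

lemma reduced_endpoint: "reduced g \<Longrightarrow> reduced (endpoint w g)"
  by (induction w) auto

lemma pointed_visit: "pointed T \<Longrightarrow> pointed (visit w T)"
  by (induction w) (auto simp: pointed_def)

lemma pointed_tree: "pointed (tree w)"
  unfolding tree_def by (rule pointed_visit) (simp add: pointed_def)

lemma visit_eq: "[] \<in> T \<Longrightarrow> visit w T = tree w \<union> endpoint w ` T"
proof (induction w)
  case (Cons y w)
  then show ?case
    by (auto simp: tree_def image_Un image_image)
qed (auto simp: tree_def)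

lemma tree_append: "tree (v @ w) = tree v \<union> endpoint v ` tree w"
  using visit_eq[of "tree w" v] pointed_tree[of w] by (simp add: tree_def pointed_def)

lemma endpoint_inverse: "reduced g \<Longrightarrow> endpoint (a @ inv_word a) g = g"
proof (induction a arbitrary: g)
  case (Cons y a)
  then have "endpoint (a @ inv_word a) (push (inv_letter y) g) = push (inv_letter y) g"
    by simp
  then show ?case
    using Cons.prems by (simp add: inv_word_def push_cancel)
qed (simp add: inv_word_def)

text \<open>
  The point of the invariant: \<open>a a\<^sup>-\<^sup>1\<close> walks along \<open>a\<close> and back, so its only effect is to add
  the vertices of \<open>a\<close>. Unions of vertex sets are idempotent and commutative, which is what the
  two defining relations require.
\<close>

lemma visit_inverse: "pointed T \<Longrightarrow> visit (a @ inv_word a) T = tree a \<union> T"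
proof (induction a arbitrary: T)
  case (Cons y a)
  have pT: "pointed (insert [] (push (inv_letter y) ` T))"
    using Cons.prems by (auto simp: pointed_def)
  have undone: "push y ` push (inv_letter y) ` T = T"
    using Cons.prems by (force simp: image_image push_cancel pointed_def)
  have "push y [] \<in> push y ` tree a"
    using pointed_tree[of a] by (auto simp: pointed_def)
  then show ?case
    using Cons.IH[OF pT] undone
    by (auto simp: inv_word_def tree_def image_Un)
qed (auto simp: inv_word_def tree_def pointed_def)

lemma fi_cong_invariants:
  assumes "(a, b) \<in> fi_cong X"
  shows "(\<forall>g. reduced g \<longrightarrow> endpoint a g = endpoint b g) \<and>
    (\<forall>T. pointed T \<longrightarrow> visit a T = visit b T)"
  using assms
proof induction
  case (fi_inverse a)
  have "endpoint (a @ inv_word a @ a) g = endpoint a g" if "reduced g" for g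
    using endpoint_inverse[of "endpoint a g" a] reduced_endpoint[OF that] by simp
  moreover have "visit (a @ inv_word a @ a) T = visit a T" if "pointed T" for T
    using visit_inverse[OF pointed_visit[OF that, of a], of a] visit_eq[of T a] that
    by (auto simp: pointed_def)
  ultimately show ?case by blast
next
  case (fi_commute a b)
  have "endpoint (a @ inv_word a @ b @ inv_word b) g = g" if "reduced g" for a b :: "'a letter list" and g
    using endpoint_inverse[OF that, of b] endpoint_inverse[OF that, of a] by simp
  moreover have "visit (a @ inv_word a @ b @ inv_word b) T = tree a \<union> (tree b \<union> T)"
    if "pointed T" for a b :: "'a letter list" and T
    using visit_inverse[OF that, of b] visit_inverse[OF pointed_visit[OF that, of "b @ inv_word b"], of a]
    by simp
  ultimately show ?case by (simp add: Un_left_commute)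
next
  case (fi_mult a b c d)
  then show ?case by (simp add: reduced_endpoint pointed_visit)
qed auto

lemma fi_cong_munn:
  assumes "(a, b) \<in> fi_cong X"
  shows "tree a = tree b" and "endpoint a [] = endpoint b []"
  using fi_cong_invariants[OF assms] by (auto simp: tree_def pointed_def)


section \<open>Canonical idempotents as depth-first traversals\<close>

text \<open>
  \<open>traversal X R es\<close> describes a closed depth-first walk by the list \<open>es\<close> of its branches at the
  root. The relation \<open>R\<close> is imposed on the initial letters of siblings, at every depth: with
  \<open>R = - Id\<close> these are the factor lists of canonical idempotents, with \<open>R = r - Id\<close> those of
  ordered canonical idempotents. The last letter \<open>y\<^sup>-\<^sup>1\<close> of a branch must not begin one of its
  sub-branches, as that would lead back to the root too early.
\<close>

inductive traversal :: "'a set \<Rightarrow> 'a letter rel \<Rightarrow> 'a letter list list \<Rightarrow> bool"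
  for X :: "'a set" and R :: "'a letter rel" where
  traversal_Nil: "traversal X R []"
| traversal_Cons: "\<lbrakk>y \<in> letters X; traversal X R gs; inv_letter y \<notin> hd ` set gs;
    traversal X R es; \<forall>e\<in>set es. (y, hd e) \<in> R\<rbrakk> \<Longrightarrow>
    traversal X R ((y # concat gs @ [inv_letter y]) # es)"

lemma traversal_Cons_iff:
  "traversal X R (e # es) \<longleftrightarrow>
    traversal X R [e] \<and> traversal X R es \<and> (\<forall>f\<in>set es. (hd e, hd f) \<in> R)"
proof
  assume "traversal X R (e # es)"
  then show "traversal X R [e] \<and> traversal X R es \<and> (\<forall>f\<in>set es. (hd e, hd f) \<in> R)"
    by cases (auto intro: traversal_Nil traversal_Cons)
next
  assume *: "traversal X R [e] \<and> traversal X R es \<and> (\<forall>f\<in>set es. (hd e, hd f) \<in> R)"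
  then have "traversal X R [e]" by blast
  then show "traversal X R (e # es)"
    using * by cases (auto intro: traversal_Cons)
qed

lemma traversal_iff:
  "traversal X R es \<longleftrightarrow>
    (\<forall>e\<in>set es. traversal X R [e]) \<and> sorted_wrt (\<lambda>e f. (hd e, hd f) \<in> R) es"
proof (induction es)
  case (Cons e es)
  then show ?case using traversal_Cons_iff[of X R e es] by auto
qed (simp add: traversal_Nil)

lemma traversal_single_iff:
  "traversal X R [e] \<longleftrightarrow>
    (\<exists>y gs. e = y # concat gs @ [inv_letter y] \<and> y \<in> letters X \<and> traversal X R gs \<and>
      inv_letter y \<notin> hd ` set gs)"
proof
  assume "traversal X R [e]"
  then show "\<exists>y gs. e = y # concat gs @ [inv_letter y] \<and> y \<in> letters X \<and> traversal X R gs \<and>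
      inv_letter y \<notin> hd ` set gs"
    by cases auto
qed (auto intro: traversal_Cons traversal_Nil)

lemma traversal_mono: "traversal X R es \<Longrightarrow> R \<subseteq> R' \<Longrightarrow> traversal X R' es"
proof (induction rule: traversal.induct)
  case (traversal_Cons y gs es)
  then show ?case by (auto intro!: traversal.traversal_Cons)
qed (simp add: traversal_Nil)

lemma traversal_words: "traversal X R es \<Longrightarrow> concat es \<in> lists (letters X)"
  by (induction rule: traversal.induct) auto

lemma traversal_last: "traversal X R es \<Longrightarrow> e \<in> set es \<Longrightarrow> e \<noteq> [] \<and> last e = inv_letter (hd e)"
  by (induction rule: traversal.induct) auto

lemma endpoint_traversal:
  "traversal X R es \<Longrightarrow> reduced g \<Longrightarrow> endpoint (concat es) g = g"
  by (induction arbitrary: g rule: traversal.induct) (simp_all add: push_cancel)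

lemma tree_traversal_append:
  assumes "traversal X R es"
  shows "tree (concat es @ w) = tree (concat es) \<union> tree w"
proof -
  have "endpoint (concat es) t = t" if "t \<in> tree w" for t
    using that endpoint_traversal[OF assms] pointed_tree[of w] by (auto simp: pointed_def)
  then show ?thesis by (simp add: tree_append)
qed

lemma tree_Cons: "tree (y # w) = insert [] (push y ` tree w)"
  by (simp add: tree_def)

lemma tree_Cons_reduced:
  assumes "\<And>s. inv_letter y # s \<notin> tree w"
  shows "tree (y # w) = insert [] ((#) y ` tree w)"
proof -
  have "push y ` tree w = (#) y ` tree w"
    using assms by (intro image_cong refl push_eq_Cons) auto
  then show ?thesis by (simp add: tree_Cons)
qed

text \<open>
  A branch \<open>y g y\<^sup>-\<^sup>1\<close> contributes the tree of \<open>g\<close> translated by \<open>y\<close>. Since \<open>g\<close> never goes back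
  along \<open>y\<^sup>-\<^sup>1\<close>, no cancellation occurs and the translation is plain consing. The root is not
  lost, because it belongs to the tree of \<open>w\<close>.
\<close>

lemma tree_traversal_Cons:
  assumes gs: "traversal X R gs" and no: "\<And>s. inv_letter y # s \<notin> tree (concat gs)"
  shows "tree ((y # concat gs @ [inv_letter y]) @ w) = (#) y ` tree (concat gs) \<union> tree w"
proof -
  have red: "reduced t" if "t \<in> tree w" for t
    using that pointed_tree[of w] by (auto simp: pointed_def)
  have undone: "push y ` push (inv_letter y) ` tree w = tree w"
    using red by (force simp: image_image push_cancel)
  have "push y ` tree (concat gs) = (#) y ` tree (concat gs)"
    using no by (intro image_cong refl push_eq_Cons) auto
  moreover have "[] \<in> tree (concat gs)" "[] \<in> tree w"
    using pointed_tree by (auto simp: pointed_def)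
  ultimately show ?thesis
    using tree_traversal_append[OF gs, of "inv_letter y # w"] undone
    by (auto simp: tree_Cons image_Un)
qed

text \<open>
  The initial letters of the factors can be read off the tree, hence off the word alone. This
  takes the place of unique factorisation of canonical idempotents, in particular for
  \<^const>\<open>idem_factors\<close>.
\<close>

lemma heads_tree_traversal:
  assumes "traversal X R es"
  shows "y # t \<in> tree (concat es) \<Longrightarrow> y \<in> hd ` set es"
    and "y \<in> hd ` set es \<Longrightarrow> [y] \<in> tree (concat es)"
proof -
  have "(\<forall>y t. y # t \<in> tree (concat es) \<longrightarrow> y \<in> hd ` set es) \<and>
      (\<forall>y \<in> hd ` set es. [y] \<in> tree (concat es))"
    using assms
  proof (induction rule: traversal.induct)
    case (traversal_Cons y gs es)
    then have no: "inv_letter y # s \<notin> tree (concat gs)" for s by blast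
    have "[] \<in> tree (concat gs)"
      using pointed_tree by (auto simp: pointed_def)
    then show ?case
      using traversal_Cons.IH tree_traversal_Cons[OF traversal_Cons.hyps(2) no, of "concat es"]
      by auto
  qed (simp add: tree_def)
  then show "y # t \<in> tree (concat es) \<Longrightarrow> y \<in> hd ` set es"
    and "y \<in> hd ` set es \<Longrightarrow> [y] \<in> tree (concat es)" by blast+
qed

lemma tree_traversal_factor:
  assumes gs: "traversal X R gs" and y: "inv_letter y \<notin> hd ` set gs"
  shows "tree (concat ((y # concat gs @ [inv_letter y]) # es)) = (#) y ` tree (concat gs) \<union> tree (concat es)"
proof -
  have no: "inv_letter y # s \<notin> tree (concat gs)" for s
    using heads_tree_traversal(1)[OF gs] y by blast
  show ?thesis using tree_traversal_Cons[OF gs no, of "concat es"] by simp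
qed

lemma heads_eq:
  assumes "traversal X R es" "traversal X' R' es'" "concat es = concat es'"
  shows "hd ` set es = hd ` set es'"
proof -
  have "hd ` set es = {y. [y] \<in> tree (concat es)}" "hd ` set es' = {y. [y] \<in> tree (concat es')}"
    using heads_tree_traversal[OF assms(1)] heads_tree_traversal[OF assms(2)] by blast+
  then show ?thesis using assms(3) by simp
qed

text \<open>
  Separates, in a tree, the part beyond the edge \<open>y\<close> from the rest.
\<close>

lemma Cons_image_split:
  assumes eq: "(#) y ` A \<union> B = (#) y ` A' \<union> B'"
    and B: "\<And>s. y # s \<notin> B" and B': "\<And>s. y # s \<notin> B'"
  shows "A = A'" and "B = B'"
proof -
  have "A = {t. y # t \<in> (#) y ` A \<union> B}" using B by auto
  also have "\<dots> = A'" unfolding eq using B' by auto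
  finally show "A = A'" .
  have "B = ((#) y ` A \<union> B) - range ((#) y)" using B by auto
  also have "\<dots> = B'" unfolding eq using B' by auto
  finally show "B = B'" .
qed

text \<open>
  The first branch starts with the \<open>R\<close>-least edge at the root, so the tree determines it; the
  vertices beyond that edge form the tree of this branch and the others the tree of the
  remaining branches.
\<close>

lemma traversal_unique:
  assumes "traversal X R es" "traversal X R es'" "tree (concat es) = tree (concat es')"
    and asym: "\<And>a b. (a, b) \<in> R \<Longrightarrow> (b, a) \<notin> R"
  shows "es = es'"
  using assms(1-3)
proof (induction arbitrary: es' rule: traversal.induct)
  case traversal_Nil
  then show ?case using heads_tree_traversal(2)[OF traversal_Nil(1)]
    by (cases es') (auto simp: tree_def)
next
  case (traversal_Cons y gs es)
  let ?e = "y # concat gs @ [inv_letter y]"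
  have t: "traversal X R (?e # es)"
    using traversal_Cons.hyps by (rule traversal.traversal_Cons)
  have "hd ` set (?e # es) = {y. [y] \<in> tree (concat (?e # es))}"
    using heads_tree_traversal[OF t] by blast
  also have "\<dots> = hd ` set es'"
    unfolding traversal_Cons.prems(2) using heads_tree_traversal[OF traversal_Cons.prems(1)] by blast
  finally have heads: "insert y (hd ` set es) = hd ` set es'" by simp
  then have "es' \<noteq> []" by auto
  with traversal_Cons.prems(1) obtain y' gs' es1' where
    es': "es' = (y' # concat gs' @ [inv_letter y']) # es1'" and gs': "traversal X R gs'"
    and ngs': "inv_letter y' \<notin> hd ` set gs'" and es1': "traversal X R es1'"
    and ord': "\<forall>e\<in>set es1'. (y', hd e) \<in> R"
    by (cases rule: traversal.cases) auto
  have h: "insert y (hd ` set es) = insert y' (hd ` set es1')"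
    using heads unfolding es' by simp
  note ord = \<open>\<forall>e\<in>set es. (y, hd e) \<in> R\<close>
  have yy: "y' = y"
  proof (rule ccontr)
    assume neq: "y' \<noteq> y"
    have "y' \<in> insert y (hd ` set es)" unfolding h by simp
    then have "y' \<in> hd ` set es" using neq by simp
    then have 1: "(y, y') \<in> R"
      using ord by (metis imageE)
    have "y \<in> insert y' (hd ` set es1')" unfolding h[symmetric] by simp
    then have "y \<in> hd ` set es1'" using neq by simp
    then have "(y', y) \<in> R"
      using ord' by (metis imageE)
    with 1 show False using asym by metis
  qed
  have irr: "y \<notin> hd ` set es"
    using ord asym by (metis imageE)
  have irr': "y \<notin> hd ` set es1'"
    using ord' asym yy by (metis imageE)
  have no: "y # s \<notin> tree (concat es)" for s
    using irr heads_tree_traversal(1)[OF \<open>traversal X R es\<close>] by metis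
  have no': "y # s \<notin> tree (concat es1')" for s
    using irr' heads_tree_traversal(1)[OF es1'] by metis
  have eq: "(#) y ` tree (concat gs) \<union> tree (concat es) =
      (#) y ` tree (concat gs') \<union> tree (concat es1')"
    using traversal_Cons.prems(2)
    unfolding tree_traversal_factor[OF traversal_Cons.hyps(2,3)]
      es' yy tree_traversal_factor[OF gs' ngs'[unfolded yy]] .
  show ?case
    using traversal_Cons.IH(1)[OF gs'] traversal_Cons.IH(2)[OF es1']
      Cons_image_split[OF eq no no'] es' yy by simp
qed


lemma distinct_heads_iff: "distinct (map hd es) \<longleftrightarrow> sorted_wrt (\<lambda>e f. (hd e, hd f) \<in> - Id) es"
  by (induction es) auto

lemma canonical_idem_imp_traversal:
  "canonical_idem X e es \<Longrightarrow> traversal X (- Id) es \<and> e = concat es"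
  and prime_canonical_idem_imp_traversal:
  "prime_canonical_idem X e \<Longrightarrow> traversal X (- Id) [e]"
proof (induction rule: canonical_idem_prime_canonical_idem.inducts)
  case (prime_canonical h hs x)
  then show ?case
    by (auto simp: traversal_single_iff intro!: exI[of _ "inv_letter x"] exI[of _ hs])
next
  case (canonical_prod es)
  then show ?case
    using distinct_heads_iff[of es] traversal_iff[of X "- Id" es] by auto
qed (auto simp: traversal_Nil)

lemma traversal_imp_canonical_idem:
  assumes "traversal X R es" "R \<subseteq> - Id"
  shows "canonical_idem X (concat es) es" and "\<forall>e\<in>set es. prime_canonical_idem X e"
proof -
  have "canonical_idem X (concat es) es \<and> (\<forall>e\<in>set es. prime_canonical_idem X e)"
    using assms(1)
  proof (induction rule: traversal.induct)
    case (traversal_Cons y gs es)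
    let ?e = "y # concat gs @ [inv_letter y]"
    have "\<forall>f\<in>set gs. hd f \<noteq> inv_letter y"
      using traversal_Cons.hyps(3) by (metis imageI)
    then have "prime_canonical_idem X ([inv_letter (inv_letter y)] @ concat gs @ [inv_letter y])"
      using traversal_Cons by (intro prime_canonical[of X "concat gs" gs]) simp_all
    then have primes: "\<forall>e\<in>set (?e # es). prime_canonical_idem X e"
      using traversal_Cons.IH by simp
    have "traversal X (- Id) (?e # es)"
      using traversal_mono[OF traversal.traversal_Cons[OF traversal_Cons.hyps] assms(2)] .
    then have "distinct (map hd (?e # es))"
      using distinct_heads_iff traversal_iff by blast
    then have "canonical_idem X (concat (?e # es)) (?e # es)"
      using primes canonical_prod[of "?e # es" X] canonical_prime[of X ?e]
      by (cases es) auto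
    with primes show ?case by blast
  qed (simp add: canonical_empty)
  then show "canonical_idem X (concat es) es" "\<forall>e\<in>set es. prime_canonical_idem X e" by blast+
qed

lemma idem_factors_heads:
  assumes "traversal X R es"
  shows "hd ` idem_factors X (concat es) \<subseteq> hd ` set es"
  using heads_eq[OF assms] canonical_idem_imp_traversal
  unfolding idem_factors_def by blast

lemma lenlex_heads:
  assumes "length u = length v" "u \<noteq> []" "v \<noteq> []" "hd u \<noteq> hd v" "irrefl R"
  shows "(p @ u, p @ v) \<in> lenlex R \<longleftrightarrow> (hd u, hd v) \<in> R"
  using assms by (cases u; cases v) (auto simp: Cons_lenlex_iff dest: lenlex_length)

text \<open>
  Exchanging two branches \<open>e\<close> and \<open>f\<close> keeps the length and makes the words differ first at the
  initial letters of \<open>e\<close> and \<open>f\<close>. Minimality among all permutations thus forces the initial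
  letters to increase, and the converse below compares the first branches that differ.
\<close>

lemma sorted_if_minimal:
  assumes "\<forall>es'. mset es' = mset es \<longrightarrow> deglex_le r (concat es) (concat es')"
    and "distinct (map hd es)" and "\<forall>e\<in>set es. e \<noteq> []"
  shows "sorted_wrt (\<lambda>e f. (hd e, hd f) \<in> r - Id) es"
  using assms
proof (induction es)
  case (Cons e es)
  have irr: "irrefl (r - Id)" by (simp add: irrefl_def)
  have "(hd e, hd f) \<in> r - Id" if f: "f \<in> set es" for f
  proof -
    obtain bs cs where es: "es = bs @ f # cs" using split_list[OF f] by blast
    have "mset (f # bs @ e # cs) = mset (e # es)" using es by simp
    then have "deglex_le r (concat (e # es)) (concat (f # bs @ e # cs))"
      using Cons.prems(1) by blast
    moreover have "hd e \<noteq> hd f" "e \<noteq> []" "f \<noteq> []" using Cons.prems that by auto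
    moreover have "hd (concat (e # es)) = hd e" "hd (concat (f # bs @ e # cs)) = hd f"
      using \<open>e \<noteq> []\<close> \<open>f \<noteq> []\<close> by simp_all
    ultimately have "(concat (e # es), concat (f # bs @ e # cs)) \<in> lenlex (r - Id)"
      unfolding deglex_le_def deglex_less_def by metis
    then show ?thesis
      using lenlex_heads[of "concat (e # es)" "concat (f # bs @ e # cs)" "r - Id" "[]"] irr
        \<open>hd e \<noteq> hd f\<close> \<open>e \<noteq> []\<close> \<open>f \<noteq> []\<close> es by simp
  qed
  moreover have "deglex_le r (concat es) (concat es')" if "mset es' = mset es" for es'
  proof -
    have "deglex_le r (concat (e # es)) (concat (e # es'))" using Cons.prems(1) that by (metis mset.simps(2))
    then show ?thesis using irr by (auto simp: deglex_le_def deglex_less_def)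
  qed
  ultimately show ?case using Cons by simp
qed simp

lemma minimal_if_sorted:
  assumes "sorted_wrt (\<lambda>e f. (hd e, hd f) \<in> r - Id) es" "\<forall>e\<in>set es. e \<noteq> []"
    and "mset es' = mset es"
  shows "deglex_le r (concat es) (concat es')"
  using assms
proof (induction es arbitrary: es')
  case (Cons e es)
  have irr: "irrefl (r - Id)" by (simp add: irrefl_def)
  obtain f fs where es': "es' = f # fs"
    using Cons.prems(3) by (cases es') auto
  show ?case
  proof (cases "f = e")
    case True
    then have "mset fs = mset es" using Cons.prems(3) es' by simp
    then have "deglex_le r (concat es) (concat fs)" using Cons by simp
    then show ?thesis using irr es' True by (auto simp: deglex_le_def deglex_less_def)
  next
    case False
    have "f \<in> set (e # es)" using Cons.prems(3) es' by (metis list.set_intros(1) set_mset_mset)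
    then have f: "f \<in> set es" using False by simp
    then have less: "(hd e, hd f) \<in> r - Id" and ne: "e \<noteq> []" "f \<noteq> []"
      using Cons.prems by auto
    have "length (concat (e # es)) = length (concat es')"
      using Cons.prems(3) by (metis length_concat mset_map sum_mset_sum_list)
    then have "(concat (e # es), concat es') \<in> lenlex (r - Id)"
      using lenlex_heads[of "concat (e # es)" "concat es'" "r - Id" "[]"] less ne es' irr by simp
    then show ?thesis by (simp add: deglex_le_def deglex_less_def)
  qed
qed (simp add: deglex_le_def)

text \<open>
  A factor in an ordered product is assumed prime as a canonical idempotent and ordered as an
  idempotent; that it is an ordered prime idempotent follows because its tree has only one edge
  at the root.
\<close>

lemma traversal_of_prime:
  assumes e: "prime_canonical_idem X e" and gs: "traversal X R gs" "R \<subseteq> - Id" "e = concat gs"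
  shows "gs = [e]"
proof -
  have e': "traversal X (- Id) [e]" using prime_canonical_idem_imp_traversal[OF e] .
  then have heads: "hd ` set gs = {hd e}"
    using heads_eq[OF gs(1) e'] gs(3) by simp
  have "distinct (map hd gs)"
    using traversal_mono[OF gs(1,2)] distinct_heads_iff traversal_iff by blast
  then have "length gs = 1"
    using distinct_card[of "map hd gs"] heads by simp
  then show ?thesis using gs(3) by (auto simp: length_Suc_conv)
qed

lemma ordered_idem_imp_traversal:
  "ordered_idem X r e \<Longrightarrow> \<exists>es. traversal X (r - Id) es \<and> e = concat es"
  and ordered_prime_idem_imp_traversal:
  "ordered_prime_idem X r e \<Longrightarrow> traversal X (r - Id) [e]"
proof (induction rule: ordered_idem_ordered_prime_idem.inducts)
  case ordered_empty
  then show ?case using traversal_Nil by (intro exI[of _ "[]"]) simp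
next
  case (ordered_prime_canonical h hs x)
  then obtain gs where gs: "traversal X (r - Id) gs" "h = concat gs" by blast
  have "traversal X (- Id) hs" "h = concat hs"
    using canonical_idem_imp_traversal[OF ordered_prime_canonical(1)] by blast+
  then have "hd ` set gs = hd ` set hs"
    using heads_eq[OF gs(1)] gs(2) by simp
  then have "x \<notin> hd ` set gs" using ordered_prime_canonical by auto
  then show ?case
    using gs ordered_prime_canonical
    by (auto simp: traversal_single_iff intro!: exI[of _ "inv_letter x"] exI[of _ gs])
next
  case (ordered_prime e)
  then show ?case by (intro exI[of _ "[e]"]) simp
next
  case (ordered_prod es)
  have single: "traversal X (r - Id) [e]" if e: "e \<in> set es" for e
  proof -
    obtain gs where "traversal X (r - Id) gs" "e = concat gs"
      using bspec[OF ordered_prod(4) e] by blast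
    moreover have "prime_canonical_idem X e" using ordered_prod e by simp
    moreover have "r - Id \<subseteq> - Id" by blast
    ultimately show ?thesis
      using traversal_of_prime[of X e "r - Id" gs] by metis
  qed
  then have "\<forall>e\<in>set es. e \<noteq> []" using traversal_last by (metis list.set_intros(1))
  then have "sorted_wrt (\<lambda>e f. (hd e, hd f) \<in> r - Id) es"
    using sorted_if_minimal[of es r] ordered_prod by simp
  then have "traversal X (r - Id) es" using single traversal_iff[of X "r - Id" es] by blast
  then show ?case by blast
qed

lemma traversal_imp_ordered_idem:
  assumes "traversal X (r - Id) es"
  shows "ordered_idem X r (concat es)" and "\<forall>e\<in>set es. ordered_prime_idem X r e"
proof -
  have sub: "r - Id \<subseteq> - Id" by blast
  have "ordered_idem X r (concat es) \<and> (\<forall>e\<in>set es. ordered_prime_idem X r e)"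
    using assms
  proof (induction rule: traversal.induct)
    case (traversal_Cons y gs es)
    let ?es = "(y # concat gs @ [inv_letter y]) # es"
    have t: "traversal X (r - Id) ?es"
      using traversal.traversal_Cons[OF traversal_Cons.hyps] .
    have "\<forall>f\<in>set gs. hd f \<noteq> inv_letter y"
      using traversal_Cons.hyps(3) by (metis imageI)
    then have "ordered_prime_idem X r ([inv_letter (inv_letter y)] @ concat gs @ [inv_letter y])"
      using traversal_Cons traversal_imp_canonical_idem(1)[OF traversal_Cons.hyps(2) sub]
      by (intro ordered_prime_canonical[of X "concat gs" gs]) simp_all
    then have primes: "\<forall>e\<in>set ?es. ordered_prime_idem X r e"
      using traversal_Cons.IH by simp
    have ne: "\<forall>e\<in>set ?es. e \<noteq> []" using traversal_last[OF t] by blast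
    have sorted: "sorted_wrt (\<lambda>e f. (hd e, hd f) \<in> r - Id) ?es"
      using t traversal_iff by blast
    have dist: "distinct (map hd ?es)"
      using traversal_mono[OF t sub] distinct_heads_iff traversal_iff by blast
    have "ordered_idem X r (concat ?es)"
    proof (cases es)
      case Nil
      then show ?thesis using primes ordered_prime by fastforce
    next
      case (Cons e es1)
      show ?thesis
      proof (rule ordered_prod)
        show "1 < length ?es" using Cons by simp
        show "\<forall>e\<in>set ?es. prime_canonical_idem X e"
          using traversal_imp_canonical_idem(2)[OF t sub] .
        show "distinct (map hd ?es)" by (fact dist)
        show "\<forall>e\<in>set ?es. ordered_idem X r e" using primes ordered_prime by blast
        show "\<forall>es'. mset es' = mset ?es \<longrightarrow> deglex_le r (concat ?es) (concat es')"
          using minimal_if_sorted[OF sorted ne] by blast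
      qed
    qed
    with primes show ?case by blast
  qed (simp add: ordered_empty)
  then show "ordered_idem X r (concat es)" "\<forall>e\<in>set es. ordered_prime_idem X r e" by blast+
qed



section \<open>Normal forms as walks\<close>

text \<open>
  A walk along a geodesic \<open>p\<^sub>1 \<dots> p\<^sub>n\<close> with a closed traversal at each vertex. The set \<open>C\<close> contains
  the edges that must not be used at the first vertex: it is empty at the root and otherwise
  consists of the edge leading back. The next geodesic edge is forbidden to the traversal as well.
\<close>

inductive walk :: "'a set \<Rightarrow> 'a letter rel \<Rightarrow> 'a letter set \<Rightarrow> 'a letter list \<Rightarrow> bool"
  for X :: "'a set" and R :: "'a letter rel" where
  walk_end: "\<lbrakk>traversal X R es; hd ` set es \<inter> C = {}\<rbrakk> \<Longrightarrow> walk X R C (concat es)"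
| walk_step: "\<lbrakk>traversal X R es; hd ` set es \<inter> insert p C = {}; p \<in> letters X; p \<notin> C;
    walk X R {inv_letter p} w\<rbrakk> \<Longrightarrow> walk X R C (concat es @ p # w)"

lemma walk_Nil: "walk X R C []"
  using walk_end[OF traversal_Nil] by simp

lemma endpoint_in_tree: "endpoint w [] \<in> tree w"
  by (induction w) (auto simp: tree_def)

lemma tree_walk:
  "walk X R C w \<Longrightarrow> y \<in> C \<Longrightarrow> y # s \<notin> tree w"
proof (induction arbitrary: y s rule: walk.induct)
  case (walk_end es C)
  then have "y \<notin> hd ` set es" by auto
  then show ?case using heads_tree_traversal(1)[OF walk_end.hyps(1)] by metis
next
  case (walk_step es p C w)
  have "tree (p # w) = insert [] ((#) p ` tree w)"
    using walk_step.IH by (intro tree_Cons_reduced) simp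
  moreover have "y \<notin> hd ` set es" using walk_step.prems walk_step.hyps(2) by auto
  then have "y # s \<notin> tree (concat es)"
    using heads_tree_traversal(1)[OF walk_step.hyps(1)] by metis
  ultimately show ?case
    using walk_step.prems walk_step.hyps(4) by (auto simp: tree_traversal_append[OF walk_step.hyps(1)])
qed

text \<open>
  As \<open>w\<close> never returns along \<open>p\<close>, its vertices and endpoint are translated without cancellation.
\<close>

lemma munn_walk_step:
  assumes "traversal X R es" "walk X R {inv_letter p} w"
  shows "endpoint (concat es @ p # w) [] = p # endpoint w []"
    and "tree (concat es @ p # w) = (#) p ` tree w \<union> tree (concat es)"
proof -
  have no: "inv_letter p # s \<notin> tree w" for s
    using tree_walk[OF assms(2)] by simp
  have "push p (endpoint w []) = p # endpoint w []"
    using no endpoint_in_tree[of w] by (intro push_eq_Cons) auto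
  moreover have "reduced (push p (endpoint w []))"
    using reduced_endpoint[of "[]" "p # w"] by simp
  ultimately show "endpoint (concat es @ p # w) [] = p # endpoint w []"
    using endpoint_traversal[OF assms(1)] by simp
  have "[] \<in> tree (concat es)"
    using pointed_tree by (auto simp: pointed_def)
  then show "tree (concat es @ p # w) = (#) p ` tree w \<union> tree (concat es)"
    using tree_traversal_append[OF assms(1), of "p # w"] tree_Cons_reduced[OF no] by auto
qed

text \<open>
  The endpoint tells whether the geodesic goes on and along which edge \<open>p\<close>. The edge \<open>p\<close>
  splits the tree into the tree of the initial traversal and that of the remaining walk.
\<close>

lemma walk_unique:
  assumes "walk X R C w" "walk X R C' w'" "tree w = tree w'" "endpoint w [] = endpoint w' []"
    and asym: "\<And>a b. (a, b) \<in> R \<Longrightarrow> (b, a) \<notin> R"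
  shows "w = w'"
  using assms(1-4)
proof (induction arbitrary: C' w' rule: walk.induct)
  case (walk_end es C)
  have "endpoint w' [] = []"
    using walk_end.prems(3) endpoint_traversal[OF walk_end.hyps(1)] by simp
  with walk_end.prems(1) obtain es' where "traversal X R es'" "w' = concat es'"
    by cases (auto simp: munn_walk_step(1) simp del: endpoint_simps)
  then show ?case
    using traversal_unique[OF walk_end.hyps(1), of es'] walk_end.prems(2) asym by blast
next
  case (walk_step es p C w)
  note munn = munn_walk_step[OF walk_step.hyps(1,5)]
  have end_w': "endpoint w' [] = p # endpoint w []"
    using walk_step.prems(3) munn(1) by simp
  from walk_step.prems(1) show ?case
  proof cases
    case (walk_end es')
    then show ?thesis using end_w' endpoint_traversal[of X R es' "[]"] by simp
  next
    case (walk_step es' p' w1)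
    note munn' = munn_walk_step[OF walk_step(2,6)]
    have p: "p' = p" and ends: "endpoint w1 [] = endpoint w []"
      using end_w' munn'(1) walk_step(1) by simp_all
    have eq: "(#) p ` tree w \<union> tree (concat es) = (#) p ` tree w1 \<union> tree (concat es')"
      using walk_step.prems(2) munn(2) munn'(2) walk_step(1) p by simp
    have irr: "p \<notin> hd ` set es" "p \<notin> hd ` set es'"
      using \<open>hd ` set es \<inter> insert p C = {}\<close> walk_step(3) p by auto
    have no: "p # s \<notin> tree (concat es)" for s
      using heads_tree_traversal(1)[OF \<open>traversal X R es\<close>] irr(1) by metis
    have no': "p # s \<notin> tree (concat es')" for s
      using heads_tree_traversal(1)[OF walk_step(2)] irr(2) by metis
    have "w = w1"
      using walk_step.IH[OF walk_step(6)] Cons_image_split(1)[OF eq no no'] ends by simp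
    moreover have "es = es'"
      using traversal_unique[OF \<open>traversal X R es\<close> walk_step(2)] Cons_image_split(2)[OF eq no no'] asym
      by blast
    ultimately show ?thesis using walk_step(1) p by simp
  qed
qed


section \<open>Irreducible words are walks\<close>

text \<open>
  Only the new branch \<open>f\<close> and its neighbour can be out of order, and then they form the
  left-hand side of a relation of type (a).
\<close>

lemma traversal_merge:
  assumes r: "trans r" "total_on (letters X) r" "antisym r"
    and f: "traversal X (r - Id) [f]" and es: "traversal X (r - Id) es"
    and new: "hd f \<notin> hd ` set es"
    and irr: "\<forall>(u, v)\<in>fi_rels X r. \<not> sublist u (f @ concat es)"
  shows "traversal X (r - Id) (f # es)"
proof (cases es)
  case Nil
  then show ?thesis using f by simp
next
  case (Cons e es1)
  have e: "traversal X (r - Id) [e]" and rest: "\<forall>g\<in>set es1. (hd e, hd g) \<in> r - Id"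
    using es unfolding Cons traversal_Cons_iff[of X _ e es1] by blast+
  have ne: "f \<noteq> []" "e \<noteq> []" and neq: "hd f \<noteq> hd e"
    using traversal_last[OF f] traversal_last[OF e] new Cons by auto
  have "hd f \<in> letters X" "hd e \<in> letters X"
    using f e by (auto simp: traversal_single_iff)
  then have cases: "(hd f, hd e) \<in> r \<or> (hd e, hd f) \<in> r"
    using r(2) neq by (auto simp: total_on_def)
  have "(hd e, hd f) \<notin> r"
  proof
    assume "(hd e, hd f) \<in> r"
    then have "(e @ f, f @ e) \<in> lenlex (r - Id)"
      using lenlex_heads[of "e @ f" "f @ e" "r - Id" "[]"] ne neq by (simp add: irrefl_def)
    moreover have "canonical_idem X (f @ e) [f, e]"
    proof -
      have "traversal X (- Id) [f]" "traversal X (- Id) [e]"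
        using traversal_mono[OF f] traversal_mono[OF e] by blast+
      then have "traversal X (- Id) [f, e]"
        using neq traversal_Cons_iff[of X "- Id" f "[e]"] by simp
      then show ?thesis
        using traversal_imp_canonical_idem(1)[of X "- Id" "[f, e]"] by simp
    qed
    ultimately have "(f @ e, e @ f) \<in> fi_rels X r"
      using traversal_imp_ordered_idem(2)[OF f] traversal_imp_ordered_idem(2)[OF e]
      by (auto intro!: rel_a simp: deglex_less_def)
    moreover have "sublist (f @ e) (f @ concat es)"
      unfolding Cons sublist_def by (intro exI[of _ "[]"] exI[of _ "concat es1"]) simp
    ultimately show False using irr by blast
  qed
  then have less: "(hd f, hd e) \<in> r - Id" using cases neq by blast
  have "(hd f, hd g) \<in> r - Id" if "g \<in> set es" for g
  proof -
    have "g = e \<or> (hd e, hd g) \<in> r - Id" using that rest Cons by auto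
    then have "(hd f, hd g) \<in> r"
      using less r(1) by (auto dest: transD)
    then show ?thesis using that new by force
  qed
  then show ?thesis using f es traversal_Cons_iff[of X _ f es] by blast
qed

text \<open>
  Putting a step \<open>y\<close> in front either extends the geodesic backwards or, if the geodesic starts
  with \<open>y\<^sup>-\<^sup>1\<close>, closes a new branch \<open>y g y\<^sup>-\<^sup>1\<close> at the second vertex of the geodesic, which is
  where the walk now starts. The only other possibility is
  that some branch \<open>y\<^sup>-\<^sup>1 g y\<close> of the first traversal crosses the same edge; then the word starts
  with \<open>y b y\<^sup>-\<^sup>1 g y\<close>, where \<open>b\<close> comprises the branches before it, and this is the left-hand side
  of a relation of type (b).
\<close>

lemma walk_Cons:
  assumes r: "trans r" "total_on (letters X) r" "antisym r"
    and w: "walk X (r - Id) {} w" and y: "y \<in> letters X"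
    and irr: "\<forall>(u, v)\<in>fi_rels X r. \<not> sublist u (y # w)"
  shows "walk X (r - Id) {} (y # w)"
proof -
  \<comment> \<open>The relation of type (b) is used with \<open>x = y\<^sup>-\<^sup>1\<close>.\<close>
  have no_backtrack: "inv_letter y \<notin> hd ` set es"
    if es: "traversal X (r - Id) es" and w: "w = concat es @ v" for es v
  proof
    assume "inv_letter y \<in> hd ` set es"
    then obtain f bs cs where f: "hd f = inv_letter y" and split: "es = bs @ f # cs"
      by (metis imageE split_list)
    have "traversal X (r - Id) [f]"
      using es traversal_iff[of X _ es] split by simp
    then obtain gs where gs: "f = inv_letter y # concat gs @ [y]"
      using f by (auto simp: traversal_single_iff)
    have bs: "traversal X (r - Id) bs"
      using es traversal_iff[of X _ es] traversal_iff[of X _ bs] split by (simp add: sorted_wrt_append)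
    have "inv_letter y \<notin> hd ` set bs"
      using es traversal_iff[of X _ es] split f by (force simp: sorted_wrt_append)
    then have e: "traversal X (r - Id) [y # concat bs @ [inv_letter y]]"
      using bs y by (auto simp: traversal_single_iff)
    have "([inv_letter (inv_letter y)] @ concat bs @ [inv_letter y] @ concat gs @ [inv_letter (inv_letter y)],
        concat gs @ [inv_letter (inv_letter y)] @ concat bs) \<in> fi_rels X r"
      using traversal_imp_ordered_idem(2)[OF e] traversal_imp_ordered_idem(2)[OF \<open>traversal X (r - Id) [f]\<close>] y gs
      by (intro rel_b) simp_all
    moreover have "sublist ([inv_letter (inv_letter y)] @ concat bs @ [inv_letter y] @ concat gs @ [inv_letter (inv_letter y)]) (y # w)"
      unfolding w split gs sublist_def
      by (intro exI[of _ "[]"] exI[of _ "concat cs @ v"]) simp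
    ultimately show False using irr by blast
  qed
  have nil: "walk X (r - Id) {} (y # w)" if "walk X (r - Id) {inv_letter y} w"
    using walk_step[OF traversal_Nil _ y _ that, of "{}"] by simp
  from w show ?thesis
  proof cases
    case (walk_end es)
    then have "walk X (r - Id) {inv_letter y} w"
      using no_backtrack[of es "[]"] walk.walk_end[OF walk_end(2), of "{inv_letter y}"] by simp
    then show ?thesis by (rule nil)
  next
    case (walk_step es p w1)
    have nb: "inv_letter y \<notin> hd ` set es"
      using no_backtrack[OF walk_step(2,1)] .
    show ?thesis
    proof (cases "p = inv_letter y")
      case False
      have "hd ` set es \<inter> insert p {inv_letter y} = {}"
        using walk_step(3) nb by simp
      from walk.walk_step[OF walk_step(2) this walk_step(4) _ walk_step(6)]
      have "walk X (r - Id) {inv_letter y} w"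
        using False walk_step(1) by simp
      then show ?thesis by (rule nil)
    next
      case True
      define f where "f = y # concat es @ [inv_letter y]"
      have f: "traversal X (r - Id) [f]" and hdf: "hd f = y"
        using walk_step(2) nb y by (auto simp: traversal_single_iff f_def)
      have word: "y # w = f @ w1" using walk_step(1) True f_def by simp
      have merge: "traversal X (r - Id) (f # es1)"
        if es1: "traversal X (r - Id) es1" and "y \<notin> hd ` set es1" "w1 = concat es1 @ v" for es1 v
      proof (rule traversal_merge[OF r f es1])
        show "hd f \<notin> hd ` set es1" using that hdf by simp
        have "sublist u (y # w)" if "sublist u (f @ concat es1)" for u
          using that unfolding word \<open>w1 = _\<close>
          by (metis append_assoc sublist_appendI sublist_append_rightI sublist_order.order_trans)
        then show "\<forall>(u, v)\<in>fi_rels X r. \<not> sublist u (f @ concat es1)"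
          using irr by blast
      qed
      have "walk X (r - Id) {y} w1" using walk_step(6) True by simp
      then show ?thesis
      proof cases
        case (walk_end es1)
        then have "traversal X (r - Id) (f # es1)" by (intro merge[of _ "[]"]) auto
        from walk.walk_end[OF this, of "{}"] show ?thesis
          unfolding word walk_end(1) by simp
      next
        case (walk_step es1 q w2)
        then have t: "traversal X (r - Id) (f # es1)" by (intro merge[of _ "q # w2"]) auto
        have "hd ` set (f # es1) \<inter> insert q {} = {}" using walk_step hdf by auto
        from walk.walk_step[OF t this _ _ walk_step(6)] show ?thesis
          using walk_step(4) unfolding word walk_step(1) by simp
      qed
    qed
  qed
qed

lemma Irr_imp_walk:
  assumes r: "trans r" "total_on (letters X) r" "antisym r"
    and w: "w \<in> Irr X (fi_rels X r)"
  shows "walk X (r - Id) {} w"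
  using w
proof (induction w)
  case (Cons y w)
  have "sublist u (y # w)" if "sublist u w" for u
    using that by (simp add: sublist_Cons_right)
  then have "w \<in> Irr X (fi_rels X r)" using Cons.prems unfolding Irr_def by auto
  then show ?case
    using walk_Cons[OF r Cons.IH, of y] Cons.prems unfolding Irr_def by auto
qed (rule walk_Nil)


section \<open>The relations hold in the free inverse monoid\<close>

text \<open>
  The words that represent an idempotent of the free inverse monoid, in the form to which the
  commutation relation applies directly.
\<close>

definition projection :: "'a set \<Rightarrow> 'a letter list \<Rightarrow> bool" where
  "projection X e \<longleftrightarrow> (\<exists>a\<in>lists (letters X). (e, a @ inv_word a) \<in> fi_cong X)"

lemma inv_word_simps [simp]:
  "inv_word [] = []"
  "inv_word (y # w) = inv_word w @ [inv_letter y]"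
  "inv_word (v @ w) = inv_word w @ inv_word v"
  "inv_word (inv_word w) = w"
  by (simp_all add: inv_word_def rev_map comp_def)

lemma fi_subst:
  assumes "(a, b) \<in> fi_cong X" "p \<in> lists (letters X)" "q \<in> lists (letters X)"
  shows "(p @ a @ q, p @ b @ q) \<in> fi_cong X"
  by (intro fi_mult fi_refl assms)

lemma projection_in_lists: "projection X e \<Longrightarrow> e \<in> lists (letters X)"
  using fi_cong_words by (fastforce simp: projection_def)

lemma projection_Nil: "projection X []"
  unfolding projection_def by (intro bexI[of _ "[]"]) (auto intro: fi_refl)

lemma projection_conj:
  assumes "projection X e" "y \<in> letters X"
  shows "projection X (y # e @ [inv_letter y])"
proof -
  obtain a where a: "a \<in> lists (letters X)" "(e, a @ inv_word a) \<in> fi_cong X"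
    using assms(1) unfolding projection_def by blast
  then have "([y] @ e @ [inv_letter y], [y] @ (a @ inv_word a) @ [inv_letter y]) \<in> fi_cong X"
    using assms(2) by (intro fi_subst) auto
  then show ?thesis
    unfolding projection_def using a(1) assms(2) by (intro bexI[of _ "y # a"]) auto
qed

lemma projection_commute:
  assumes "projection X e" "projection X f"
  shows "(e @ f, f @ e) \<in> fi_cong X"
proof -
  obtain a b where ab: "a \<in> lists (letters X)" "(e, a @ inv_word a) \<in> fi_cong X"
    "b \<in> lists (letters X)" "(f, b @ inv_word b) \<in> fi_cong X"
    using assms unfolding projection_def by blast
  have "(e @ f, a @ inv_word a @ b @ inv_word b) \<in> fi_cong X"
    "(f @ e, b @ inv_word b @ a @ inv_word a) \<in> fi_cong X"
    using fi_mult[OF ab(2,4)] fi_mult[OF ab(4,2)] by simp_all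
  then show ?thesis
    using fi_commute[OF ab(1,3)] by (meson fi_trans fi_sym)
qed

text \<open>
  With \<open>c = a a\<^sup>-\<^sup>1 b\<close>, commutation and \<open>a a\<^sup>-\<^sup>1 a = a\<close> turn \<open>c c\<^sup>-\<^sup>1 = a a\<^sup>-\<^sup>1 b b\<^sup>-\<^sup>1 a a\<^sup>-\<^sup>1\<close> into
  \<open>a a\<^sup>-\<^sup>1 b b\<^sup>-\<^sup>1\<close>.
\<close>

lemma projection_append:
  assumes "projection X e" "projection X f"
  shows "projection X (e @ f)"
proof -
  obtain a b where ab: "a \<in> lists (letters X)" "(e, a @ inv_word a) \<in> fi_cong X"
    "b \<in> lists (letters X)" "(f, b @ inv_word b) \<in> fi_cong X"
    using assms unfolding projection_def by blast
  let ?c = "a @ inv_word a @ b"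
  have "(?c @ inv_word ?c, a @ inv_word a @ a @ inv_word a @ b @ inv_word b) \<in> fi_cong X"
    using fi_subst[OF fi_commute[OF ab(3,1)], of "a @ inv_word a" "[]"] ab(1) by simp
  moreover have "(a @ inv_word a @ a @ inv_word a @ b @ inv_word b, a @ inv_word a @ b @ inv_word b) \<in> fi_cong X"
    using fi_mult[OF fi_inverse[OF ab(1)] fi_refl[of "inv_word a @ b @ inv_word b" X]] ab by simp
  moreover have "(e @ f, a @ inv_word a @ b @ inv_word b) \<in> fi_cong X"
    using fi_mult[OF ab(2,4)] by simp
  ultimately have "(e @ f, ?c @ inv_word ?c) \<in> fi_cong X"
    by (meson fi_sym fi_trans)
  then show ?thesis
    unfolding projection_def using ab by (intro bexI[of _ ?c]) auto
qed

lemma projection_traversal: "traversal X R es \<Longrightarrow> projection X (concat es)"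
proof (induction rule: traversal.induct)
  case (traversal_Cons y gs es)
  then show ?case
    using projection_append[OF projection_conj[OF traversal_Cons.IH(1)] traversal_Cons.IH(2)] by simp
qed (simp add: projection_Nil)

text \<open>
  For (b) with \<open>y = x\<^sup>-\<^sup>1\<close>: idempotents commute, so
  \<open>(y e y\<^sup>-\<^sup>1) f y = f (y e y\<^sup>-\<^sup>1) y = f y (e y\<^sup>-\<^sup>1 y) = f y (y\<^sup>-\<^sup>1 y e) = f y e\<close>, and two letters
  are saved.
\<close>

lemma fi_rels_decrease:
  assumes "(u, v) \<in> fi_rels X r"
  shows "(u, v) \<in> fi_cong X" and "(v, u) \<in> lenlex (r - Id)"
proof -
  have "(u, v) \<in> fi_cong X \<and> (v, u) \<in> lenlex (r - Id)"
    using assms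
  proof cases
    case (rel_a e f fs)
    have "projection X e" "projection X f"
      using projection_traversal[OF ordered_prime_idem_imp_traversal[OF rel_a(3)]]
        projection_traversal[OF ordered_prime_idem_imp_traversal[OF rel_a(4)]] by simp_all
    then show ?thesis using rel_a projection_commute by (auto simp: deglex_less_def)
  next
    case (rel_b x e f)
    define y where "y = inv_letter x"
    have x: "x = inv_letter y" and y: "y \<in> letters X" using rel_b(3) by (simp_all add: y_def)
    have "traversal X (r - Id) [y # e @ [inv_letter y]]" "traversal X (r - Id) [inv_letter y # f @ [y]]"
      using ordered_prime_idem_imp_traversal[OF rel_b(4)] ordered_prime_idem_imp_traversal[OF rel_b(5)]
      unfolding x by simp_all
    then obtain es fs where "traversal X (r - Id) es" "e = concat es"
      "traversal X (r - Id) fs" "f = concat fs"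
      by (auto simp: traversal_single_iff)
    then have e: "projection X e" and f: "projection X f"
      using projection_traversal by blast+
    have words: "[y] \<in> lists (letters X)" "e \<in> lists (letters X)" "f \<in> lists (letters X)" "[] \<in> lists (letters X)"
      using y e f projection_in_lists by auto
    have "projection X [inv_letter y, y]"
      using projection_conj[OF projection_Nil, of "inv_letter y" X] y by simp
    then have "((y # e @ [inv_letter y]) @ f, f @ (y # e @ [inv_letter y])) \<in> fi_cong X"
      "(e @ [inv_letter y, y], [inv_letter y, y] @ e) \<in> fi_cong X"
      "([y] @ inv_word [y] @ [y], [y]) \<in> fi_cong X"
      using projection_commute e f y projection_conj fi_inverse[OF words(1)] by blast+
    from fi_subst[OF this(1) words(4,1)] fi_subst[OF this(2), of "f @ [y]" "[]"] fi_subst[OF this(3), of f e]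
    have "((y # e @ [inv_letter y]) @ f @ [y], f @ [y] @ e) \<in> fi_cong X"
      using words by (auto intro: fi_trans)
    then show ?thesis unfolding rel_b(1,2) x by (simp add: lenlex_conv)
  qed
  then show "(u, v) \<in> fi_cong X" "(v, u) \<in> lenlex (r - Id)" by blast+
qed

lemma minimal_imp_Irr:
  assumes w: "w \<in> lists (letters X)"
    and min: "\<And>v. (v, w) \<in> fi_cong X \<Longrightarrow> (v, w) \<notin> lenlex (r - Id)"
  shows "w \<in> Irr X (fi_rels X r)"
proof -
  have False if uv: "(u, v) \<in> fi_rels X r" and sub: "sublist u w" for u v
  proof -
    obtain p q where pq: "w = p @ u @ q" using sub unfolding sublist_def by blast
    have "(p @ v @ q, w) \<in> fi_cong X"
      unfolding pq using w pq by (intro fi_subst fi_sym[OF fi_rels_decrease(1)[OF uv]]) auto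
    moreover have "(p @ v @ q, w) \<in> lenlex (r - Id)"
      unfolding pq using lenlex_append1[OF fi_rels_decrease(2)[OF uv], of q q]
      by (simp add: irrefl_def)
    ultimately show False using min by blast
  qed
  then show ?thesis using w unfolding Irr_def by blast
qed


section \<open>Walks written as in the statement\<close>

definition spell :: "nat \<Rightarrow> (nat \<Rightarrow> 'b list) \<Rightarrow> (nat \<Rightarrow> 'b list) \<Rightarrow> 'b list" where
  "spell m u e = u 0 @ concat (map (\<lambda>i. e i @ u i) [1..<Suc m])"

definition well_formed ::
  "'a set \<Rightarrow> 'a letter rel \<Rightarrow> nat \<Rightarrow> (nat \<Rightarrow> 'a letter list) \<Rightarrow> (nat \<Rightarrow> 'a letter list) \<Rightarrow> bool" where
  "well_formed X r m u e \<longleftrightarrow>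
    (\<forall>i\<in>{0..m}. u i \<in> lists (letters X)) \<and>
    (\<forall>i. 1 \<le> i \<and> i < m \<longrightarrow> u i \<noteq> []) \<and>
    (\<forall>y\<in>letters X. \<not> sublist [y, inv_letter y] (concat (map u [0..<Suc m]))) \<and>
    (\<forall>i\<in>{1..m}. ordered_idem X r (e i) \<and>
      (\<forall>f\<in>idem_factors X (e i).
        (u i \<noteq> [] \<longrightarrow> hd f \<noteq> hd (u i)) \<and>
        (u (i - 1) \<noteq> [] \<longrightarrow> last f \<noteq> last (u (i - 1)))))"

lemma reduced_iff:
  assumes "w \<in> lists (letters X)"
  shows "(\<forall>y\<in>letters X. \<not> sublist [y, inv_letter y] w) \<longleftrightarrow> reduced w"
  using assms by (induction w rule: reduced.induct) (auto simp: sublist_Cons_right)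

lemma reduced_append: "reduced (v @ w) \<Longrightarrow> reduced v \<and> reduced w"
  by (induction v rule: reduced.induct) (auto simp: reduced_Cons)

lemma reduced_junction: "reduced (v @ w) \<Longrightarrow> v \<noteq> [] \<Longrightarrow> w \<noteq> [] \<Longrightarrow> hd w \<noteq> inv_letter (last v)"
  by (induction v rule: reduced.induct) (auto simp: reduced_Cons neq_Nil_conv)

lemma idem_factors_traversal:
  assumes "traversal X (r - Id) es" "f \<in> set es"
  shows "f \<in> idem_factors X (concat es)"
  using traversal_imp_canonical_idem(1)[OF assms(1)] assms(2) unfolding idem_factors_def by blast

lemma idem_factors_last:
  assumes "f \<in> idem_factors X e"
  shows "last f = inv_letter (hd f)"
  using assms canonical_idem_imp_traversal traversal_last unfolding idem_factors_def by blast

text \<open>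
  A block \<open>u\<close> of several letters is a stretch of the geodesic with empty traversals at its inner
  vertices.
\<close>

lemma walk_prepend:
  assumes "u \<noteq> []" "reduced u" "u \<in> lists (letters X)" "hd u \<notin> C"
    and "traversal X R es" "hd ` set es \<inter> insert (hd u) C = {}"
    and "walk X R {inv_letter (last u)} w"
  shows "walk X R C (concat es @ u @ w)"
  using assms
proof (induction u arbitrary: es C)
  case (Cons p u)
  have "walk X R {inv_letter p} (u @ w)"
  proof (cases "u = []")
    case True
    then show ?thesis using Cons.prems(7) by simp
  next
    case False
    then have "walk X R {inv_letter p} (concat [] @ u @ w)"
      using Cons.prems by (intro Cons.IH) (auto simp: reduced_Cons traversal_Nil neq_Nil_conv)
    then show ?thesis by simp
  qed
  with Cons.prems have "walk X R C (concat es @ p # (u @ w))"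
    by (intro walk_step) simp_all
  then show ?case by simp
qed simp

lemma upt_split: "i \<le> n \<Longrightarrow> [0..<n] = [0..<i] @ [i..<n]"
  using upt_add_eq_append[of 0 i "n - i"] by simp

text \<open>
  By descending induction on \<open>i\<close>, the part after the block \<open>u\<^sub>i\<close> is a walk that does not start
  back along the last letter of \<open>u\<^sub>i\<close>. An empty block can only be the outer one \<open>u\<^sub>0\<close> or \<open>u\<^sub>m\<close>.
\<close>

lemma well_formed_imp_walk:
  assumes wf: "well_formed X r m u e"
  shows "walk X (r - Id) {} (spell m u e)"
proof -
  define C where "C i = (if u i = [] then {} else {inv_letter (last (u i))})" for i
  define rest where "rest i = concat (map (\<lambda>i. e i @ u i) [i..<Suc m])" for i
  have words: "u i \<in> lists (letters X)" if "i \<le> m" for i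
    using wf that unfolding well_formed_def by auto
  have "concat (map u [0..<Suc m]) \<in> lists (letters X)"
    using words by (force simp: less_Suc_eq_le simp del: upt_Suc)
  then have red: "reduced (concat (map u [0..<Suc m]))"
    using wf reduced_iff unfolding well_formed_def by blast
  have red_u: "reduced (u i)" if "i \<le> m" for i
  proof -
    have "[0..<Suc m] = [0..<i] @ i # [Suc i..<Suc m]"
      using that upt_split[of i "Suc m"] upt_conv_Cons[of i "Suc m"] by simp
    then have "reduced (concat (map u [0..<i]) @ u i @ concat (map u [Suc i..<Suc m]))"
      using red by (simp del: upt_Suc)
    then show ?thesis using reduced_append by blast
  qed
  have junction: "hd (u (Suc i)) \<notin> C i" if "Suc i \<le> m" "u (Suc i) \<noteq> []" for i
  proof -
    have "[0..<Suc m] = [0..<i] @ i # Suc i # [Suc (Suc i)..<Suc m]"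
      using that upt_split[of i "Suc m"] upt_conv_Cons[of i "Suc m"] upt_conv_Cons[of "Suc i" "Suc m"]
      by simp
    then have "reduced (concat (map u [0..<i]) @ (u i @ u (Suc i)) @ concat (map u [Suc (Suc i)..<Suc m]))"
      using red by (simp del: upt_Suc)
    then have "reduced (u i @ u (Suc i))" using reduced_append by blast
    then show ?thesis using reduced_junction that by (auto simp: C_def)
  qed
  have "walk X (r - Id) (C i) (rest (Suc i))" if "i \<le> m" for i
    using that
  proof (induction i rule: inc_induct)
    case base
    then show ?case by (simp add: rest_def walk_Nil)
  next
    case (step i)
    then have i: "Suc i \<in> {1..m}" by simp
    have rest: "rest (Suc i) = e (Suc i) @ u (Suc i) @ rest (Suc (Suc i))"
      using i unfolding rest_def by (subst upt_conv_Cons) (auto simp del: upt_Suc)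
    have "ordered_idem X r (e (Suc i))"
      using wf i unfolding well_formed_def by blast
    then obtain es where es: "traversal X (r - Id) es" "e (Suc i) = concat es"
      using ordered_idem_imp_traversal by blast
    have fact: "(u (Suc i) \<noteq> [] \<longrightarrow> hd f \<noteq> hd (u (Suc i))) \<and> hd f \<notin> C i" if f: "f \<in> set es" for f
    proof -
      have f': "f \<in> idem_factors X (e (Suc i))"
        using idem_factors_traversal[OF es(1) f] es(2) by simp
      then have "(u (Suc i) \<noteq> [] \<longrightarrow> hd f \<noteq> hd (u (Suc i))) \<and> (u i \<noteq> [] \<longrightarrow> last f \<noteq> last (u i))"
        using wf i unfolding well_formed_def by fastforce
      then show ?thesis using idem_factors_last[OF f'] by (auto simp: C_def)
    qed
    show ?case
    proof (cases "u (Suc i) = []")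
      case True
      then have "\<not> Suc i < m" using wf unfolding well_formed_def by auto
      then have "rest (Suc (Suc i)) = []" by (simp add: rest_def)
      then have "rest (Suc i) = concat es" using rest True es(2) by simp
      moreover have "hd ` set es \<inter> C i = {}" using fact by auto
      ultimately show ?thesis using walk_end[OF es(1)] by simp
    next
      case False
      have "walk X (r - Id) (C i) (concat es @ u (Suc i) @ rest (Suc (Suc i)))"
      proof (rule walk_prepend[OF False])
        show "reduced (u (Suc i))" "u (Suc i) \<in> lists (letters X)" "hd (u (Suc i)) \<notin> C i"
          using i red_u words junction False by auto
        have "hd f \<notin> insert (hd (u (Suc i))) (C i)" if "f \<in> set es" for f
          using fact[OF that] False by auto
        then show "hd ` set es \<inter> insert (hd (u (Suc i))) (C i) = {}" by blast
        show "walk X (r - Id) {inv_letter (last (u (Suc i)))} (rest (Suc (Suc i)))"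
          using step.IH False by (simp add: C_def)
      qed (fact es(1))
      then show ?thesis using rest es(2) by simp
    qed
  qed
  then have 0: "walk X (r - Id) (C 0) (rest (Suc 0))" by simp
  have spell: "spell m u e = u 0 @ rest (Suc 0)" by (simp add: spell_def rest_def)
  show ?thesis
  proof (cases "u 0 = []")
    case True
    then show ?thesis using 0 spell by (simp add: C_def)
  next
    case False
    then have "walk X (r - Id) {} (concat [] @ u 0 @ rest (Suc 0))"
      using 0 red_u[of 0] words[of 0] by (intro walk_prepend traversal_Nil) (auto simp: C_def)
    then show ?thesis using spell by simp
  qed
qed

text \<open>
  Since the \<open>e\<^sub>i\<close> may be empty, blocks of single letters suffice: a geodesic with \<open>n\<close> edges gives
  \<open>m = n + 1\<close> idempotents and empty outer blocks \<open>u\<^sub>0\<close> and \<open>u\<^sub>m\<close>. The conditions on \<open>C\<close> in the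
  conclusion serve the induction: they supply reducedness and the condition on \<open>e\<^sub>1\<close> after an
  edge has been put in front.
\<close>

lemma walk_imp_well_formed:
  assumes "walk X (r - Id) C w"
  shows "\<exists>m u e. u 0 = [] \<and> w = spell m u e \<and> well_formed X r m u e \<and>
    (\<forall>f\<in>idem_factors X (e 1). hd f \<notin> C) \<and> (\<forall>y\<in>C. \<forall>s. concat (map u [0..<Suc m]) \<noteq> y # s)"
  using assms
proof (induction rule: walk.induct)
  case (walk_end es C)
  have "\<forall>f\<in>idem_factors X (concat es). hd f \<notin> C"
    using idem_factors_heads[OF walk_end(1)] walk_end(2) by blast
  then show ?case
    using traversal_imp_ordered_idem(1)[OF walk_end(1)]
    by (intro exI[of _ 1] exI[of _ "\<lambda>_. []"] exI[of _ "\<lambda>_. concat es"])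
      (auto simp: spell_def well_formed_def)
next
  case (walk_step es p C w)
  then obtain m u e where u0: "u 0 = []" and w: "w = spell m u e"
    and wf: "well_formed X r m u e"
    and e1: "\<forall>f\<in>idem_factors X (e 1). hd f \<noteq> inv_letter p"
    and path: "\<And>s. concat (map u [0..<Suc m]) \<noteq> inv_letter p # s"
    by auto
  \<comment> \<open>Both sequences are shifted by one; the formerly empty block \<open>u\<^sub>0\<close> becomes the edge \<open>p\<close>.\<close>
  define u' where "u' = case_nat [] (u(0 := [p]))"
  define e' where "e' = case_nat [] (e(0 := concat es))"
  have heads: "\<forall>f\<in>idem_factors X (concat es). hd f \<notin> insert p C"
    using idem_factors_heads[OF walk_step.hyps(1)] walk_step.hyps(2) by blast
  have split: "[0..<Suc m] = 0 # [1..<Suc m]"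
    by (simp add: upt_conv_Cons del: upt_Suc)
  have "map (\<lambda>i. e' i @ u' i) [1..<Suc (Suc m)] = map (\<lambda>i. (e(0 := concat es)) i @ (u(0 := [p])) i) [0..<Suc m]"
    unfolding One_nat_def map_Suc_upt[symmetric] map_map by (simp add: u'_def e'_def comp_def)
  also have "\<dots> = (concat es @ [p]) # map (\<lambda>i. e i @ u i) [1..<Suc m]"
    unfolding split by (simp del: upt_Suc)
  finally have eq: "map (\<lambda>i. e' i @ u' i) [1..<Suc (Suc m)] =
      (concat es @ [p]) # map (\<lambda>i. e i @ u i) [1..<Suc m]" .
  have spell': "spell (Suc m) u' e' = concat es @ p # w"
    unfolding w spell_def eq by (simp add: u0 u'_def del: upt_Suc)
  have "map u' [0..<Suc (Suc m)] = [] # map (u(0 := [p])) [0..<Suc m]"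
    by (subst upt_conv_Cons) (simp_all add: u'_def map_Suc_upt[symmetric] comp_def del: upt_Suc)
  then have path': "concat (map u' [0..<Suc (Suc m)]) = p # concat (map u [0..<Suc m])"
    unfolding split by (simp add: u0 del: upt_Suc)
  have words: "u i \<in> lists (letters X)" if "i \<le> m" for i
    using wf that unfolding well_formed_def by auto
  then have cw: "concat (map u [0..<Suc m]) \<in> lists (letters X)"
    by (force simp: less_Suc_eq_le simp del: upt_Suc)
  then have "reduced (concat (map u [0..<Suc m]))"
    using wf reduced_iff unfolding well_formed_def by blast
  then have "reduced (p # concat (map u [0..<Suc m]))"
    using path by (simp add: reduced_Cons)
  then have red': "\<forall>y\<in>letters X. \<not> sublist [y, inv_letter y] (concat (map u' [0..<Suc (Suc m)]))"
    unfolding path' using reduced_iff[of "p # concat (map u [0..<Suc m])" X] cw walk_step.hyps(3) by simp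
  have "well_formed X r (Suc m) u' e'"
    unfolding well_formed_def
  proof (intro conjI red')
    show "\<forall>i\<in>{0..Suc m}. u' i \<in> lists (letters X)"
      using words walk_step.hyps(3) by (auto simp: u'_def split: nat.split)
    show "\<forall>i. 1 \<le> i \<and> i < Suc m \<longrightarrow> u' i \<noteq> []"
      using wf unfolding well_formed_def by (auto simp: u'_def split: nat.split)
    show "\<forall>i\<in>{1..Suc m}. ordered_idem X r (e' i) \<and>
      (\<forall>f\<in>idem_factors X (e' i). (u' i \<noteq> [] \<longrightarrow> hd f \<noteq> hd (u' i)) \<and>
        (u' (i - 1) \<noteq> [] \<longrightarrow> last f \<noteq> last (u' (i - 1))))"
    proof
      fix i assume "i \<in> {1..Suc m}"
      then obtain j where i: "i = Suc j" and j: "j \<le> m" by (cases i) auto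
      show "ordered_idem X r (e' i) \<and>
        (\<forall>f\<in>idem_factors X (e' i). (u' i \<noteq> [] \<longrightarrow> hd f \<noteq> hd (u' i)) \<and>
          (u' (i - 1) \<noteq> [] \<longrightarrow> last f \<noteq> last (u' (i - 1))))"
      proof (cases j)
        case 0
        then show ?thesis
          using heads traversal_imp_ordered_idem(1)[OF walk_step.hyps(1)]
          by (auto simp: i u'_def e'_def)
      next
        case (Suc k)
        then have j': "j \<in> {1..m}" using j by simp
        have "ordered_idem X r (e j) \<and> (\<forall>f\<in>idem_factors X (e j).
            (u j \<noteq> [] \<longrightarrow> hd f \<noteq> hd (u j)) \<and> (u k \<noteq> [] \<longrightarrow> last f \<noteq> last (u k)))"
          using wf j' Suc unfolding well_formed_def by fastforce
        moreover have "last f \<noteq> p" if "k = 0" "f \<in> idem_factors X (e j)" for f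
          using that e1 Suc idem_factors_last[of f X "e j"] by auto
        ultimately show ?thesis
          using Suc by (auto simp: i u'_def e'_def split: nat.split)
      qed
    qed
  qed
  moreover have "\<forall>f\<in>idem_factors X (e' 1). hd f \<notin> C"
    using heads by (simp add: e'_def)
  moreover have "\<forall>y\<in>C. \<forall>s. concat (map u' [0..<Suc (Suc m)]) \<noteq> y # s"
    unfolding path' using walk_step.hyps(4) by auto
  moreover have "u' 0 = []" by (simp add: u'_def)
  ultimately show ?case
    using spell' by (intro exI[of _ "Suc m"] exI[of _ u'] exI[of _ e']) simp
qed


section \<open>The normal form theorem\<close>

theorem mainTheorem2:
  fixes X :: "'a set" and r :: "'a letter rel"
  assumes "well_order_on (letters X) r"
  shows
    "Irr X (fi_rels X r) =
       {w. \<exists>(m::nat) (u :: nat \<Rightarrow> 'a letter list) (e :: nat \<Rightarrow> 'a letter list).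
          w = u 0 @ concat (map (\<lambda>i. e i @ u i) [1..<Suc m]) \<and>
          (\<forall>i\<in>{0..m}. u i \<in> lists (letters X)) \<and>
          (\<forall>i. 1 \<le> i \<and> i < m \<longrightarrow> u i \<noteq> []) \<and>
          (\<forall>y\<in>letters X. \<not> sublist [y, inv_letter y] (concat (map u [0..<Suc m]))) \<and>
          (\<forall>i\<in>{1..m}. ordered_idem X r (e i) \<and>
             (\<forall>f\<in>idem_factors X (e i).
                (u i \<noteq> [] \<longrightarrow> hd f \<noteq> hd (u i)) \<and>
                (u (i - 1) \<noteq> [] \<longrightarrow> last f \<noteq> last (u (i - 1)))))}
     \<and> (\<forall>g\<in>carrier (FI X). \<exists>w\<in>Irr X (fi_rels X r). fi_class X w = g)
     \<and> (\<forall>w\<in>Irr X (fi_rels X r). \<forall>w'\<in>Irr X (fi_rels X r).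
          w \<noteq> w' \<longrightarrow> fi_class X w \<noteq> fi_class X w')
     \<and> (\<forall>w\<in>Irr X (fi_rels X r). \<forall>v\<in>lists (letters X).
          fi_class X v = fi_class X w \<longrightarrow> length w \<le> length v)"
proof -
  let ?I = "Irr X (fi_rels X r)" and ?W = "Collect (walk X (r - Id) {})"
  have r: "trans r" "total_on (letters X) r" "antisym r" and wf: "wf (r - Id)"
    using assms unfolding well_order_on_def linear_order_on_def partial_order_on_def preorder_on_def
    by blast+
  have asym: "(b, a) \<notin> r - Id" if "(a, b) \<in> r - Id" for a b
    using that r(3) by (auto dest: antisymD)
  have unique: "w = w'" if "w \<in> ?W" "w' \<in> ?W" "(w, w') \<in> fi_cong X" for w w'
    using walk_unique[of X "r - Id" "{}" w "{}" w'] fi_cong_munn[OF that(3)] that asym by blast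
  have Irr_words: "?I \<subseteq> lists (letters X)" by (auto simp: Irr_def)
  have sub: "?I \<subseteq> ?W" using Irr_imp_walk[OF r] by blast
  have minimal: "\<exists>w\<in>?I. (w, v) \<in> fi_cong X \<and> length w \<le> length v" if v: "v \<in> lists (letters X)" for v
  proof -
    obtain w where w: "(w, v) \<in> fi_cong X"
      and min: "\<And>w'. (w', w) \<in> lenlex (r - Id) \<Longrightarrow> (w', v) \<notin> fi_cong X"
    proof (rule wfE_min[OF wf_lenlex[OF wf], of v "{w. (w, v) \<in> fi_cong X}"])
      show "v \<in> {w. (w, v) \<in> fi_cong X}" using fi_refl[OF v] by simp
    qed simp
    have "w \<in> lists (letters X)" using fi_cong_words[OF w] by blast
    then have "w \<in> ?I" using min fi_trans[OF _ w] by (metis minimal_imp_Irr)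
    moreover have "\<not> length v < length w"
      using min[of v] fi_refl[OF v] by (auto simp: lenlex_conv)
    ultimately show ?thesis using w by auto
  qed
  have walk_words: "w \<in> lists (letters X)" if "walk X (r - Id) C w" for C w
    using that by induction (auto dest: traversal_words)
  \<comment> \<open>A walk is congruent to the irreducible least word of its class, which is a walk, too.\<close>
  have Irr_walk: "?I = ?W"
    using minimal unique sub walk_words by blast
  have "?W = {w. \<exists>m u e. w = spell m u e \<and> well_formed X r m u e}"
    using walk_imp_well_formed well_formed_imp_walk by blast
  then have "?I = {w. \<exists>m u e. w = spell m u e \<and> well_formed X r m u e}"
    using Irr_walk by simp
  note part1 = this[unfolded spell_def well_formed_def]
  have cong: "(v, w) \<in> fi_cong X" if "fi_class X v = fi_class X w" "v \<in> lists (letters X)" "w \<in> ?I" for v w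
    using that Irr_words fi_class_eq_iff[of v X w] by blast
  have part2: "\<forall>g\<in>carrier (FI X). \<exists>w\<in>?I. fi_class X w = g"
  proof
    fix g assume "g \<in> carrier (FI X)"
    then obtain v where v: "v \<in> lists (letters X)" "g = fi_class X v" unfolding carrier_FI by blast
    then obtain w where w: "w \<in> ?I" "(w, v) \<in> fi_cong X" using minimal by blast
    have "fi_class X w = g" unfolding v(2) using fi_class_eq_iff[of w X v] w Irr_words v(1) by blast
    then show "\<exists>w\<in>?I. fi_class X w = g" using w(1) by blast
  qed
  have part3: "\<forall>w\<in>?I. \<forall>w'\<in>?I. w \<noteq> w' \<longrightarrow> fi_class X w \<noteq> fi_class X w'"
    using cong unique sub Irr_words by blast
  have part4: "\<forall>w\<in>?I. \<forall>v\<in>lists (letters X). fi_class X v = fi_class X w \<longrightarrow> length w \<le> length v"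
  proof (intro ballI impI)
    fix w v assume w: "w \<in> ?I" and v: "v \<in> lists (letters X)" and eq: "fi_class X v = fi_class X w"
    obtain w' where w': "w' \<in> ?I" "(w', v) \<in> fi_cong X" "length w' \<le> length v"
      using minimal[OF v] by blast
    have "w' = w"
      using unique[OF _ _ fi_trans[OF w'(2) cong[OF eq v w]]] w'(1) w sub by blast
    then show "length w \<le> length v" using w'(3) by simp
  qed
  show ?thesis using part1 part2 part3 part4 by blast
qed

end
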